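(* Let $L$ be one of the following logics: $\mathbf{IL}^-$, $\mathbf{IL}^-(\mathbf{J4}_+)$, $\mathbf{IL}^-(\mathbf{J1})$, $\mathbf{IL}^-(\mathbf{J5})$, $\mathbf{IL}^-(\mathbf{J2}_+)$, $\mathbf{IL}^-(\mathbf{J1},\mathbf{J4}_+)$, $\mathbf{IL}^-(\mathbf{J4}_+,\mathbf{J5})$, $\mathbf{IL}^-(\mathbf{J1},\mathbf{J5})$, $\mathbf{CL}=\mathbf{IL}^-(\mathbf{J1},\mathbf{J2})$, $\mathbf{IL}^-(\mathbf{J1},\mathbf{J4}_+,\mathbf{J5})$. Then for every formula $A$ the following are equivalent: (1) $L\vdash A$; (2) $A$ is valid in every $\mathbf{IL}^-$-frame in which all axioms of $L$ are valid; (3) $A$ is valid in every finite $\mathbf{IL}^-$-frame in which all axioms of $L$ are valid.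
   Context: Formulas are built from countably many propositional variables, $\top,\bot$, the connectives $\neg,\land,\lor,\to$, a unary modal operator $\Box$ and a binary modal operator $\rhd$; $\Diamond A$ abbreviates $\neg\Box\neg A$. The logic $\mathbf{IL}^-$ has as axioms all tautologies, $\Box(A\to B)\to(\Box A\to\Box B)$, $\Box(\Box A\to A)\to\Box A$, $\mathbf{J3}$: $(A\rhd C)\land(B\rhd C)\to(A\lor B)\rhd C$, and $\mathbf{J6}$: $\Box A\leftrightarrow(\neg A)\rhd\bot$; its rules are modus ponens, necessitation (from $A$ infer $\Box A$), $\mathbf{R1}$ (from $A\to B$ infer $C\rhd A\to C\rhd B$) and $\mathbf{R2}$ (from $A\to B$ infer $B\rhd C\to A\rhd C$). For axiom schemata $\Sigma_1,\dots,\Sigma_n$, $\mathbf{IL}^-(\Sigma_1,\dots,\Sigma_n)$ denotes $\mathbf{IL}^-$ with these schemata added as axioms (same rules). The schemata are: $\mathbf{J1}$: $\Box(A\to B)\to A\rhd B$; $\mathbf{J2}$: $(A\rhd B)\land(B\rhd C)\to A\rhd C$; $\mathbf{J4}_+$: $\Box(A\to B)\to(C\rhd A\to C\rhd B)$; $\mathbf{J2}_+$: $(A\rhd(B\lor C))\land(B\rhd C)\to A\rhd C$; $\mathbf{J5}$: $\Diamond A\rhd A$. An $\mathbf{IL}^-$-frame is a triple $\langle W,R,\{S_x\}_{x\in W}\rangle$ with $W$ nonempty, $R$ a transitive and conversely well-founded binary relation on $W$, and each $S_x$ a binary relation on $W$ such that $y S_x z$ implies $xRy$. A model on it is given by a satisfaction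 relation $\Vdash$ with the usual Boolean clauses, $x\Vdash\Box A$ iff $y\Vdash A$ for all $y$ with $xRy$, and $x\Vdash A\rhd B$ iff for every $y$ with $xRy$ and $y\Vdash A$ there is $z$ with $yS_xz$ and $z\Vdash B$. A formula is valid in a frame if it is satisfied at every point under every satisfaction relation on the frame; an axiom schema is valid if all its instances are. *)

theory Defs
  imports Main
begin

datatype fm =
    Var nat
  | Top ("\<^bold>\<top>")
  | Bot ("\<^bold>\<bottom>")
  | Neg fm ("\<^bold>\<not> _" [80] 80)
  | And fm fm (infixr "\<^bold>\<and>" 65)
  | Or fm fm (infixr "\<^bold>\<or>" 60)
  | Imp fm fm (infixr "\<^bold>\<rightarrow>" 55)
  | Box fm ("\<box> _" [80] 80)
  | Rhd fm fm (infix "\<rhd>" 70)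

abbreviation Dia :: "fm \<Rightarrow> fm" ("\<diamond> _" [80] 80) where
  "\<diamond> A \<equiv> \<^bold>\<not> \<box> \<^bold>\<not> A"

abbreviation Iff :: "fm \<Rightarrow> fm \<Rightarrow> fm" (infix "\<^bold>\<leftrightarrow>" 50) where
  "A \<^bold>\<leftrightarrow> B \<equiv> (A \<^bold>\<rightarrow> B) \<^bold>\<and> (B \<^bold>\<rightarrow> A)"

(* Truth-functional evaluation: variables and formulas whose main operator is modal
   are treated alike as atoms, with truth values given by v. *)
primrec bool_eval :: "(fm \<Rightarrow> bool) \<Rightarrow> fm \<Rightarrow> bool" where
  "bool_eval v (Var n) = v (Var n)"
| "bool_eval v \<^bold>\<top> = True"
| "bool_eval v \<^bold>\<bottom> = False"
| "bool_eval v (\<^bold>\<not> A) = (\<not> bool_eval v A)"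
| "bool_eval v (A \<^bold>\<and> B) = (bool_eval v A \<and> bool_eval v B)"
| "bool_eval v (A \<^bold>\<or> B) = (bool_eval v A \<or> bool_eval v B)"
| "bool_eval v (A \<^bold>\<rightarrow> B) = (bool_eval v A \<longrightarrow> bool_eval v B)"
| "bool_eval v (\<box> A) = v (\<box> A)"
| "bool_eval v (A \<rhd> B) = v (A \<rhd> B)"

definition tautology :: "fm \<Rightarrow> bool" where
  "tautology A \<longleftrightarrow> (\<forall>v. bool_eval v A)"

(* An axiom schema is represented by the set of its instances. *)

definition J1 :: "fm set" where
  "J1 = {\<box> (A \<^bold>\<rightarrow> B) \<^bold>\<rightarrow> (A \<rhd> B) | A B. True}"

definition J2 :: "fm set" where
  "J2 = {((A \<rhd> B) \<^bold>\<and> (B \<rhd> C)) \<^bold>\<rightarrow> (A \<rhd> C) | A B C. True}"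

definition J2_plus :: "fm set" where
  "J2_plus = {((A \<rhd> (B \<^bold>\<or> C)) \<^bold>\<and> (B \<rhd> C)) \<^bold>\<rightarrow> (A \<rhd> C) | A B C. True}"

definition J3 :: "fm set" where
  "J3 = {((A \<rhd> C) \<^bold>\<and> (B \<rhd> C)) \<^bold>\<rightarrow> ((A \<^bold>\<or> B) \<rhd> C) | A B C. True}"

definition J4_plus :: "fm set" where
  "J4_plus = {\<box> (A \<^bold>\<rightarrow> B) \<^bold>\<rightarrow> ((C \<rhd> A) \<^bold>\<rightarrow> (C \<rhd> B)) | A B C. True}"

definition J5 :: "fm set" where
  "J5 = {(\<diamond> A) \<rhd> A | A. True}"

definition J6 :: "fm set" where
  "J6 = {\<box> A \<^bold>\<leftrightarrow> ((\<^bold>\<not> A) \<rhd> \<^bold>\<bottom>) | A. True}"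

definition ax_K :: "fm set" where
  "ax_K = {\<box> (A \<^bold>\<rightarrow> B) \<^bold>\<rightarrow> (\<box> A \<^bold>\<rightarrow> \<box> B) | A B. True}"

definition ax_Loeb :: "fm set" where
  "ax_Loeb = {\<box> (\<box> A \<^bold>\<rightarrow> A) \<^bold>\<rightarrow> \<box> A | A. True}"

(* The axioms of IL^-(Sigma), where Sigma is the union of the added schemata. *)
definition IL_axioms :: "fm set \<Rightarrow> fm set" where
  "IL_axioms \<Sigma> = {A. tautology A} \<union> ax_K \<union> ax_Loeb \<union> J3 \<union> J6 \<union> \<Sigma>"

inductive IL_proves :: "fm set \<Rightarrow> fm \<Rightarrow> bool" ("IL\<^sup>-'(_') \<turnstile> _" [0, 50] 50)
  for \<Sigma> :: "fm set" where
  Ax: "A \<in> IL_axioms \<Sigma> \<Longrightarrow> IL\<^sup>-(\<Sigma>) \<turnstile> A"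
| MP: "IL\<^sup>-(\<Sigma>) \<turnstile> A \<^bold>\<rightarrow> B \<Longrightarrow> IL\<^sup>-(\<Sigma>) \<turnstile> A \<Longrightarrow> IL\<^sup>-(\<Sigma>) \<turnstile> B"
| Nec: "IL\<^sup>-(\<Sigma>) \<turnstile> A \<Longrightarrow> IL\<^sup>-(\<Sigma>) \<turnstile> \<box> A"
| R1: "IL\<^sup>-(\<Sigma>) \<turnstile> A \<^bold>\<rightarrow> B \<Longrightarrow> IL\<^sup>-(\<Sigma>) \<turnstile> (C \<rhd> A) \<^bold>\<rightarrow> (C \<rhd> B)"
| R2: "IL\<^sup>-(\<Sigma>) \<turnstile> A \<^bold>\<rightarrow> B \<Longrightarrow> IL\<^sup>-(\<Sigma>) \<turnstile> (B \<rhd> C) \<^bold>\<rightarrow> (A \<rhd> C)"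

(* Worlds are drawn from a type 'w. Quantifying over the frames on one infinite type loses no
   generality: any carrier embeds into an infinite type ('a into 'a + nat, say) and validity is
   invariant under isomorphism. On a finite type there would be too few frames for completeness.
   Only the relations S x with x in W belong to the frame; S x is irrelevant elsewhere. *)
locale IL_frame =
  fixes W :: "'w set" and R :: "'w rel" and S :: "'w \<Rightarrow> 'w rel"
  assumes W_nonempty: "W \<noteq> {}"
    and R_on_W: "R \<subseteq> W \<times> W"
    and R_trans: "trans R"
    and R_converse_wf: "wf (R\<inverse>)"
    and S_on_W: "\<And>x. x \<in> W \<Longrightarrow> S x \<subseteq> W \<times> W"
    and S_imp_R: "\<And>x y z. x \<in> W \<Longrightarrow> (y, z) \<in> S x \<Longrightarrow> (x, y) \<in> R"

(* A satisfaction relation is determined by its restriction V to propositional variables. *)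
primrec sat :: "'w rel \<Rightarrow> ('w \<Rightarrow> 'w rel) \<Rightarrow> ('w \<Rightarrow> nat \<Rightarrow> bool) \<Rightarrow> 'w \<Rightarrow> fm \<Rightarrow> bool" where
  "sat R S V x (Var n) = V x n"
| "sat R S V x \<^bold>\<top> = True"
| "sat R S V x \<^bold>\<bottom> = False"
| "sat R S V x (\<^bold>\<not> A) = (\<not> sat R S V x A)"
| "sat R S V x (A \<^bold>\<and> B) = (sat R S V x A \<and> sat R S V x B)"
| "sat R S V x (A \<^bold>\<or> B) = (sat R S V x A \<or> sat R S V x B)"
| "sat R S V x (A \<^bold>\<rightarrow> B) = (sat R S V x A \<longrightarrow> sat R S V x B)"
| "sat R S V x (\<box> A) = (\<forall>y. (x, y) \<in> R \<longrightarrow> sat R S V y A)"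
| "sat R S V x (A \<rhd> B) =
     (\<forall>y. (x, y) \<in> R \<and> sat R S V y A \<longrightarrow> (\<exists>z. (y, z) \<in> S x \<and> sat R S V z B))"

definition frame_valid :: "'w set \<Rightarrow> 'w rel \<Rightarrow> ('w \<Rightarrow> 'w rel) \<Rightarrow> fm \<Rightarrow> bool" where
  "frame_valid W R S A \<longleftrightarrow> (\<forall>V. \<forall>x\<in>W. sat R S V x A)"

end

(* Completeness is shown with a single finite canonical frame. A world is a maximal consistent set cut
   down to a finite adequate set, together with a label C. An R-successor y of x labelled C is critical
   if it contains no B for which B |> C belongs to x, and the S_x-successors of a critical y are
   required to avoid C. If A |> C is missing from x, then some critical y labelled C contains A, which
   refutes A |> C at x. If A |> B belongs to x and a critical y labelled C contains A, then A |> C does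
   not belong to x, and so B is consistent with the negation of C. Closure under J4_plus gives such a z
   above x, and closure under J2_plus gives one that is itself critical with label C, which makes S_x
   transitive. J1 puts C |> C into x, so a critical y does not contain C; J5 puts Dia C |> C into x, so no
   R-successor of a critical y contains C. *)

theory Submission
  imports Defs
begin

section \<open>Soundness\<close>

lemma sat_bool_eval: "bool_eval (sat R S V x) A = sat R S V x A"
  by (induction A) auto

lemma sat_tautology: "tautology A \<Longrightarrow> sat R S V x A"
  by (metis sat_bool_eval tautology_def)

context IL_frame
begin

lemma soundness:
  assumes "IL\<^sup>-(\<Sigma>) \<turnstile> A" and "\<And>B. B \<in> IL_axioms \<Sigma> \<Longrightarrow> frame_valid W R S B"
  shows "frame_valid W R S A"
  using assms(1)
proof induction
  case (Nec A)
  then show ?case using R_on_W by (auto simp: frame_valid_def)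
next
  case (R1 A B C)
  \<comment> \<open>The \<open>S x\<close>-successor witnessing \<open>C \<rhd> A\<close> lies in
    \<open>W\<close>, where the valid implication applies.\<close>
  then show ?case using S_on_W unfolding frame_valid_def sat.simps by blast
next
  case (R2 A B C)
  then show ?case using R_on_W unfolding frame_valid_def sat.simps by blast
qed (use assms(2) in \<open>auto simp: frame_valid_def\<close>)

lemma Loeb_valid:
  assumes "A \<in> ax_Loeb" shows "frame_valid W R S A"
proof -
  obtain B where A: "A = \<box> (\<box> B \<^bold>\<rightarrow> B) \<^bold>\<rightarrow> \<box> B"
    using assms by (auto simp: ax_Loeb_def)
  have "(x, y) \<in> R \<longrightarrow> sat R S V y B" if x: "sat R S V x (\<box> (\<box> B \<^bold>\<rightarrow> B))" for V x y
    using R_converse_wf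
  proof (induction y rule: wf_induct_rule)
    case (less y)
    show ?case
    proof
      assume xy: "(x, y) \<in> R"
      \<comment> \<open>By transitivity \<open>z\<close> also lies above \<open>x\<close>, so the
        induction hypothesis applies to it.\<close>
      have "sat R S V z B" if "(y, z) \<in> R" for z
        using less[of z] that xy transD[OF R_trans xy] by blast
      then show "sat R S V y B" using x xy by simp
    qed
  qed
  then have "sat R S V x (\<box> (\<box> B \<^bold>\<rightarrow> B)) \<Longrightarrow> sat R S V x (\<box> B)" for V x
    unfolding sat.simps(8)[of R S V x B] by blast
  then show ?thesis unfolding frame_valid_def A sat.simps(7) by blast
qed

lemma IL_axioms_valid:
  assumes "B \<in> IL_axioms \<Sigma>" and "\<And>B. B \<in> \<Sigma> \<Longrightarrow> frame_valid W R S B"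
  shows "frame_valid W R S B"
proof -
  have "frame_valid W R S B" if "B \<in> ax_K \<union> J3 \<union> J6"
    using that by (auto simp: ax_K_def J3_def J6_def frame_valid_def)
  moreover have "frame_valid W R S B" if "tautology B"
    using that by (simp add: frame_valid_def sat_tautology)
  ultimately show ?thesis using assms Loeb_valid by (auto simp: IL_axioms_def)
qed

section \<open>Frame conditions that validate the added schemata\<close>

lemma J1_valid:
  assumes "\<And>x y. (x, y) \<in> R \<Longrightarrow> (y, y) \<in> S x" and "B \<in> J1"
  shows "frame_valid W R S B"
proof -
  obtain A C where B: "B = \<box> (A \<^bold>\<rightarrow> C) \<^bold>\<rightarrow> (A \<rhd> C)"
    using assms(2) by (auto simp: J1_def)
  show ?thesis unfolding B frame_valid_def sat.simps using assms(1) by blast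
qed

lemma J4_plus_valid:
  assumes "\<And>x y z. x \<in> W \<Longrightarrow> (y, z) \<in> S x \<Longrightarrow> (x, z) \<in> R" and "B \<in> J4_plus"
  shows "frame_valid W R S B"
proof -
  obtain A C D where B: "B = \<box> (A \<^bold>\<rightarrow> C) \<^bold>\<rightarrow> ((D \<rhd> A) \<^bold>\<rightarrow> (D \<rhd> C))"
    using assms(2) by (auto simp: J4_plus_def)
  show ?thesis unfolding B frame_valid_def sat.simps using assms(1) by blast
qed

lemma J5_valid:
  assumes "\<And>x y z. (x, y) \<in> R \<Longrightarrow> (y, z) \<in> R \<Longrightarrow> (y, z) \<in> S x" and "B \<in> J5"
  shows "frame_valid W R S B"
proof -
  obtain A where B: "B = \<diamond> A \<rhd> A"
    using assms(2) by (auto simp: J5_def)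
  show ?thesis unfolding B frame_valid_def sat.simps using assms(1) by blast
qed

text \<open>\<open>S_R\<close> puts the intermediate world above \<open>x\<close>, where
  \<open>C \<rhd> D\<close> can be applied, and transitivity joins the two steps. For
  \<open>J2_plus\<close>, an intermediate world satisfying \<open>D\<close> is already the
  witness.\<close>

lemma J2_J2_plus_valid:
  assumes S_R: "\<And>x y z. x \<in> W \<Longrightarrow> (y, z) \<in> S x \<Longrightarrow> (x, z) \<in> R"
    and S_trans: "\<And>x. x \<in> W \<Longrightarrow> trans (S x)"
    and B: "B \<in> J2 \<union> J2_plus"
  shows "frame_valid W R S B"
proof -
  have rhd: "sat R S V x (A \<rhd> D)"
    if "x \<in> W" "sat R S V x (A \<rhd> (C \<^bold>\<or> D)) \<or> sat R S V x (A \<rhd> C)" "sat R S V x (C \<rhd> D)" for V x A C D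
    using that S_R[OF that(1)] transD[OF S_trans[OF that(1)]] unfolding sat.simps by meson
  consider A C D where "B = ((A \<rhd> C) \<^bold>\<and> (C \<rhd> D)) \<^bold>\<rightarrow> (A \<rhd> D)"
    | A C D where "B = ((A \<rhd> (C \<^bold>\<or> D)) \<^bold>\<and> (C \<rhd> D)) \<^bold>\<rightarrow> (A \<rhd> D)"
    using B by (auto simp: J2_def J2_plus_def)
  then show ?thesis
    unfolding frame_valid_def by cases (use rhd in \<open>simp_all only: sat.simps(5,7), blast+\<close>)
qed

end

section \<open>Maximal consistent sets\<close>

text \<open>Necessitation, \<open>R1\<close> and \<open>R2\<close> enter only through theorems and
  never act on the assumptions in \<open>T\<close>, as the deduction theorem requires.\<close>

inductive derives :: "fm set \<Rightarrow> fm set \<Rightarrow> fm \<Rightarrow> bool" for \<Sigma> T where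
  assumed: "A \<in> T \<Longrightarrow> derives \<Sigma> T A"
| provable: "IL\<^sup>-(\<Sigma>) \<turnstile> A \<Longrightarrow> derives \<Sigma> T A"
| modus_ponens: "derives \<Sigma> T (A \<^bold>\<rightarrow> B) \<Longrightarrow> derives \<Sigma> T A \<Longrightarrow> derives \<Sigma> T B"

lemma taut: "tautology A \<Longrightarrow> IL\<^sup>-(\<Sigma>) \<turnstile> A"
  by (auto intro: Ax simp: IL_axioms_def)

lemma derives_mono: "derives \<Sigma> T A \<Longrightarrow> T \<subseteq> T' \<Longrightarrow> derives \<Sigma> T' A"
  by (induction rule: derives.induct) (auto intro: derives.intros)

lemma derives_taut_consequence:
  assumes "derives \<Sigma> T A" "derives \<Sigma> T B" "tautology (A \<^bold>\<rightarrow> B \<^bold>\<rightarrow> C)"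
  shows "derives \<Sigma> T C"
  using assms by (meson modus_ponens provable taut)

lemma deduction: "derives \<Sigma> (insert A T) B \<Longrightarrow> derives \<Sigma> T (A \<^bold>\<rightarrow> B)"
proof (induction rule: derives.induct)
  case (assumed B)
  show ?case
  proof (cases "B = A")
    case True
    then show ?thesis by (auto intro!: provable taut simp: tautology_def)
  next
    case False
    then have "derives \<Sigma> T B" using assumed by (auto intro: derives.assumed)
    then show ?thesis
      by (rule derives_taut_consequence[of _ _ B B]) (auto simp: tautology_def \<open>derives \<Sigma> T B\<close>)
  qed
next
  case (provable B)
  then have "derives \<Sigma> T B" by (rule derives.provable)
  then show ?case
    by (rule derives_taut_consequence[of _ _ B B]) (auto simp: tautology_def \<open>derives \<Sigma> T B\<close>)
next
  case (modus_ponens B C)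
  show ?case
    by (rule derives_taut_consequence[OF modus_ponens.IH]) (auto simp: tautology_def)
qed

text \<open>Of the two chain members that support the premises of a modus ponens step, the larger
  supports both.\<close>

lemma derives_chain_Union:
  assumes "derives \<Sigma> (\<Union>\<C>) A" "\<C> \<noteq> {}" "subset.chain \<A> \<C>"
  shows "\<exists>X\<in>\<C>. derives \<Sigma> X A"
  using assms(1)
proof induction
  case (modus_ponens A B)
  then obtain X Y where XY: "X \<in> \<C>" "derives \<Sigma> X (A \<^bold>\<rightarrow> B)" "Y \<in> \<C>" "derives \<Sigma> Y A" by blast
  moreover have "X \<subseteq> Y \<or> Y \<subseteq> X" using XY assms(3) by (auto simp: subset_chain_def)
  ultimately show ?case by (meson derives.modus_ponens derives_mono)
qed (use assms(2) in \<open>auto intro: derives.intros\<close>)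

text \<open>Consistency is implicit: a closed inconsistent set would contain every formula along
  with its negation.\<close>

definition mcs :: "fm set \<Rightarrow> fm set \<Rightarrow> bool" where
  "mcs \<Sigma> M \<longleftrightarrow> (\<forall>A. derives \<Sigma> M A \<longrightarrow> A \<in> M) \<and> (\<forall>A. \<^bold>\<not> A \<in> M \<longleftrightarrow> A \<notin> M)"

text \<open>Zorn's lemma extends \<open>T\<close> to a set maximal among those not deriving
  \<open>A\<close>; maximality forces negation completeness.\<close>

lemma Lindenbaum:
  assumes "\<not> derives \<Sigma> T A"
  obtains M where "mcs \<Sigma> M" "T \<subseteq> M" "A \<notin> M"
proof -
  let ?\<A> = "{X. T \<subseteq> X \<and> \<not> derives \<Sigma> X A}"
  have "\<exists>M\<in>?\<A>. \<forall>X\<in>?\<A>. M \<subseteq> X \<longrightarrow> X = M"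
  proof (rule subset_Zorn_nonempty)
    show "?\<A> \<noteq> {}" using assms by blast
  next
    fix \<C> assume C: "\<C> \<noteq> {}" "subset.chain ?\<A> \<C>"
    then have "\<not> derives \<Sigma> (\<Union>\<C>) A"
      using derives_chain_Union[of \<Sigma> \<C> A] by (auto simp: subset_chain_def)
    moreover have "T \<subseteq> \<Union>\<C>" using C unfolding subset_chain_def by blast
    ultimately show "\<Union>\<C> \<in> ?\<A>" by blast
  qed
  then obtain M where M: "T \<subseteq> M" "\<not> derives \<Sigma> M A"
    and max: "\<And>X. M \<subseteq> X \<Longrightarrow> \<not> derives \<Sigma> X A \<Longrightarrow> X = M"
    by (smt (verit, ccfv_threshold) mem_Collect_eq order_trans)
  \<comment> \<open>By maximality, adding \<open>B\<close> makes \<open>A\<close> derivable.\<close>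
  have out: "derives \<Sigma> M (B \<^bold>\<rightarrow> A)" if "B \<notin> M" for B
    using max[of "insert B M"] that deduction by blast
  have closed: "B \<in> M" if "derives \<Sigma> M B" for B
    using out that M(2) modus_ponens by blast
  have "\<^bold>\<not> B \<in> M \<longleftrightarrow> B \<notin> M" for B
  proof
    assume "\<^bold>\<not> B \<in> M"
    then have "derives \<Sigma> M A" if "B \<in> M"
      using derives_taut_consequence[OF assumed assumed, of "\<^bold>\<not> B" M B A] that
      by (auto simp: tautology_def)
    then show "B \<notin> M" using M(2) by blast
  next
    assume B: "B \<notin> M"
    have "derives \<Sigma> M A" if "\<^bold>\<not> B \<notin> M"
      using out[OF B] out[OF that] by (rule derives_taut_consequence) (auto simp: tautology_def)
    then show "\<^bold>\<not> B \<in> M" using M(2) by blast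
  qed
  then show ?thesis using that[OF _ M(1)] M(2) closed assumed unfolding mcs_def by blast
qed

primrec Disj :: "fm list \<Rightarrow> fm" where
  "Disj [] = \<^bold>\<bottom>"
| "Disj (B # Bs) = B \<^bold>\<or> Disj Bs"

lemma bool_eval_Disj [simp]: "bool_eval v (Disj Bs) \<longleftrightarrow> (\<exists>B\<in>set Bs. bool_eval v B)"
  by (induction Bs) auto

locale maximal_consistent =
  fixes \<Sigma> M
  assumes mcs: "mcs \<Sigma> M"
begin

lemma neg_iff [simp]: "\<^bold>\<not> A \<in> M \<longleftrightarrow> A \<notin> M"
  using mcs by (simp add: mcs_def)

lemma theorem_mem: "IL\<^sup>-(\<Sigma>) \<turnstile> A \<Longrightarrow> A \<in> M"
  using mcs by (auto simp: mcs_def intro: derives.intros)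

lemma mp_mem: "A \<^bold>\<rightarrow> B \<in> M \<Longrightarrow> A \<in> M \<Longrightarrow> B \<in> M"
  using mcs by (auto simp: mcs_def intro: derives.intros)

lemma theorem_mp: "IL\<^sup>-(\<Sigma>) \<turnstile> A \<^bold>\<rightarrow> B \<Longrightarrow> A \<in> M \<Longrightarrow> B \<in> M"
  using mp_mem theorem_mem by blast

lemma axiom_mem: "A \<in> ax_K \<union> ax_Loeb \<union> J3 \<union> J6 \<union> \<Sigma> \<Longrightarrow> A \<in> M"
  by (auto intro!: theorem_mem Ax simp: IL_axioms_def)

lemma taut_mp: "tautology (A \<^bold>\<rightarrow> B) \<Longrightarrow> A \<in> M \<Longrightarrow> B \<in> M"
  using theorem_mp taut by blast

lemma and_iff [simp]: "A \<^bold>\<and> B \<in> M \<longleftrightarrow> A \<in> M \<and> B \<in> M"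
proof -
  have "B \<^bold>\<rightarrow> (A \<^bold>\<and> B) \<in> M" if "A \<in> M"
    using that by (rule taut_mp[rotated]) (auto simp: tautology_def)
  moreover have "C \<in> M" if "A \<^bold>\<and> B \<in> M" "C = A \<or> C = B" for C
    using that(1) by (rule taut_mp[rotated]) (use that(2) in \<open>auto simp: tautology_def\<close>)
  ultimately show ?thesis using mp_mem by blast
qed

lemma top_mem [simp]: "\<^bold>\<top> \<in> M"
  by (rule theorem_mem[OF taut]) (simp add: tautology_def)

lemma bot_notin [simp]: "\<^bold>\<bottom> \<notin> M"
  using taut_mp[of "\<^bold>\<bottom>" "\<^bold>\<not> \<^bold>\<bottom>"] by (auto simp: tautology_def)

lemma or_iff [simp]: "A \<^bold>\<or> B \<in> M \<longleftrightarrow> A \<in> M \<or> B \<in> M"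
  using taut_mp[of "A \<^bold>\<or> B" "\<^bold>\<not> (\<^bold>\<not> A \<^bold>\<and> \<^bold>\<not> B)"] taut_mp[of "\<^bold>\<not> (\<^bold>\<not> A \<^bold>\<and> \<^bold>\<not> B)" "A \<^bold>\<or> B"]
  by (auto simp: tautology_def)

lemma imp_iff [simp]: "A \<^bold>\<rightarrow> B \<in> M \<longleftrightarrow> (A \<in> M \<longrightarrow> B \<in> M)"
  using taut_mp[of "A \<^bold>\<rightarrow> B" "\<^bold>\<not> A \<^bold>\<or> B"] taut_mp[of "\<^bold>\<not> A \<^bold>\<or> B" "A \<^bold>\<rightarrow> B"]
  by (auto simp: tautology_def)

lemma Disj_iff [simp]: "Disj Bs \<in> M \<longleftrightarrow> (\<exists>B\<in>set Bs. B \<in> M)"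
  by (induction Bs) auto

lemma box_K: "\<box> (A \<^bold>\<rightarrow> B) \<in> M \<Longrightarrow> \<box> A \<in> M \<Longrightarrow> \<box> B \<in> M"
  using axiom_mem[of "\<box> (A \<^bold>\<rightarrow> B) \<^bold>\<rightarrow> (\<box> A \<^bold>\<rightarrow> \<box> B)"] by (auto simp: ax_K_def)

lemma box_mono: "IL\<^sup>-(\<Sigma>) \<turnstile> A \<^bold>\<rightarrow> B \<Longrightarrow> \<box> A \<in> M \<Longrightarrow> \<box> B \<in> M"
  using box_K theorem_mem Nec by blast

lemma box_taut_mono: "tautology (A \<^bold>\<rightarrow> B) \<Longrightarrow> \<box> A \<in> M \<Longrightarrow> \<box> B \<in> M"
  using box_mono taut by blast

lemma box_Loeb: "\<box> (\<box> A \<^bold>\<rightarrow> A) \<in> M \<Longrightarrow> \<box> A \<in> M"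
  using axiom_mem[of "\<box> (\<box> A \<^bold>\<rightarrow> A) \<^bold>\<rightarrow> \<box> A"] by (auto simp: ax_Loeb_def)

text \<open>Necessitation and \<open>ax_K\<close> carry a derivation under the box. Contraposed, a
  missing box gives an underivability from which Lindenbaum's lemma can start.\<close>

lemma box_derives:
  "derives \<Sigma> {A. \<box> A \<in> M} B \<Longrightarrow> \<box> B \<in> M"
  by (induction rule: derives.induct) (auto intro: theorem_mem Nec box_K)

text \<open>The usual derivation of transitivity from Loeb's axiom, applied to the conjunction of
  \<open>A\<close> and \<open>\<box> A\<close>.\<close>

lemma box_box:
  assumes "\<box> A \<in> M" shows "\<box> \<box> A \<in> M"
proof -
  have split: "IL\<^sup>-(\<Sigma>) \<turnstile> \<box> (A \<^bold>\<and> \<box> A) \<^bold>\<rightarrow> \<box> B" if "B = A \<or> B = \<box> A" for B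
  proof (rule MP)
    show "IL\<^sup>-(\<Sigma>) \<turnstile> \<box> ((A \<^bold>\<and> \<box> A) \<^bold>\<rightarrow> B) \<^bold>\<rightarrow> (\<box> (A \<^bold>\<and> \<box> A) \<^bold>\<rightarrow> \<box> B)"
      by (rule Ax) (auto simp: IL_axioms_def ax_K_def)
    show "IL\<^sup>-(\<Sigma>) \<turnstile> \<box> ((A \<^bold>\<and> \<box> A) \<^bold>\<rightarrow> B)"
      using that by (intro Nec taut) (auto simp: tautology_def)
  qed
  \<comment> \<open>Boxing this implication turns \<open>\<box> A\<close> into the premise of Loeb's
    axiom for the conjunction.\<close>
  have "IL\<^sup>-(\<Sigma>) \<turnstile> A \<^bold>\<rightarrow> (\<box> (A \<^bold>\<and> \<box> A) \<^bold>\<rightarrow> (A \<^bold>\<and> \<box> A))"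
    by (rule MP[OF taut split[of A]]) (simp_all add: tautology_def)
  then have "\<box> (A \<^bold>\<and> \<box> A) \<in> M"
    using assms box_Loeb box_mono by blast
  then show ?thesis using theorem_mp[OF split[of "\<box> A"]] by blast
qed

section \<open>Formulas \<open>A \<rhd> B\<close> in a maximal consistent set\<close>

lemma J6_iff: "\<box> A \<in> M \<longleftrightarrow> \<^bold>\<not> A \<rhd> \<^bold>\<bottom> \<in> M"
  using axiom_mem[of "\<box> A \<^bold>\<leftrightarrow> (\<^bold>\<not> A \<rhd> \<^bold>\<bottom>)"] by (auto simp: J6_def)

lemma rhd_mono_right: "tautology (B \<^bold>\<rightarrow> C) \<Longrightarrow> A \<rhd> B \<in> M \<Longrightarrow> A \<rhd> C \<in> M"
  using theorem_mp R1 taut by blast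

lemma rhd_mono_left: "tautology (A \<^bold>\<rightarrow> B) \<Longrightarrow> B \<rhd> C \<in> M \<Longrightarrow> A \<rhd> C \<in> M"
  using theorem_mp R2 taut by blast

lemma rhd_or_left: "A \<rhd> C \<in> M \<Longrightarrow> B \<rhd> C \<in> M \<Longrightarrow> (A \<^bold>\<or> B) \<rhd> C \<in> M"
  using axiom_mem[of "((A \<rhd> C) \<^bold>\<and> (B \<rhd> C)) \<^bold>\<rightarrow> ((A \<^bold>\<or> B) \<rhd> C)"] by (auto simp: J3_def)

lemma rhd_if_box_neg: "\<box> \<^bold>\<not> A \<in> M \<Longrightarrow> A \<rhd> C \<in> M"
  by (rule rhd_mono_right[of "\<^bold>\<bottom>"], simp add: tautology_def, rule rhd_mono_left[of _ "\<^bold>\<not> \<^bold>\<not> A"])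
    (auto simp: tautology_def J6_iff)

lemma box_neg_iff_rhd_bot: "\<box> \<^bold>\<not> A \<in> M \<longleftrightarrow> A \<rhd> \<^bold>\<bottom> \<in> M"
  using rhd_if_box_neg rhd_mono_left[of "\<^bold>\<not> \<^bold>\<not> A" A "\<^bold>\<bottom>"] by (auto simp: J6_iff tautology_def)

text \<open>This boxed form of \<open>R2\<close> follows from \<open>J3\<close> and
  \<open>J6\<close>: \<open>A\<close> splits into \<open>A \<and> \<not> B\<close> and
  \<open>B\<close>, and the first is refuted under the box. The boxed form of \<open>R1\<close> is
  the extra schema \<open>J4_plus\<close>.\<close>

lemma rhd_antimono_box:
  assumes "\<box> (A \<^bold>\<rightarrow> B) \<in> M" "B \<rhd> C \<in> M" shows "A \<rhd> C \<in> M"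
proof -
  have "\<box> \<^bold>\<not> (A \<^bold>\<and> \<^bold>\<not> B) \<in> M"
    using assms(1) by (rule box_taut_mono[rotated]) (auto simp: tautology_def)
  then have "((A \<^bold>\<and> \<^bold>\<not> B) \<^bold>\<or> B) \<rhd> C \<in> M"
    using rhd_if_box_neg rhd_or_left assms(2) by blast
  then show ?thesis by (rule rhd_mono_left[rotated]) (auto simp: tautology_def)
qed

lemma Disj_rhd:
  assumes "\<And>B. B \<in> set Bs \<Longrightarrow> B \<rhd> C \<in> M" shows "Disj Bs \<rhd> C \<in> M"
  using assms
proof (induction Bs)
  case Nil
  have "\<box> \<^bold>\<not> \<^bold>\<bottom> \<in> M" by (intro theorem_mem Nec taut) (simp add: tautology_def)
  then show ?case by (simp add: rhd_if_box_neg)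
qed (simp add: rhd_or_left)

text \<open>Loeb's axiom lets the successor contain \<open>\<box> \<^bold>\<not> A\<close>, a boxed formula missing from \<open>M\<close>; this
  makes the canonical \<open>R\<close> irreflexive.\<close>

lemma exists_successor:
  assumes "\<box> \<^bold>\<not> A \<notin> M"
  obtains N where "mcs \<Sigma> N" "A \<in> N" "\<box> \<^bold>\<not> A \<in> N" "\<And>B. \<box> B \<in> M \<Longrightarrow> B \<in> N \<and> \<box> B \<in> N"
proof -
  have "\<not> derives \<Sigma> {B. \<box> B \<in> M} (\<box> \<^bold>\<not> A \<^bold>\<rightarrow> \<^bold>\<not> A)"
    using box_derives box_Loeb assms by blast
  then obtain N where N: "mcs \<Sigma> N" "{B. \<box> B \<in> M} \<subseteq> N" "(\<box> \<^bold>\<not> A \<^bold>\<rightarrow> \<^bold>\<not> A) \<notin> N"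
    by (rule Lindenbaum)
  interpret N: maximal_consistent \<Sigma> N using N(1) by unfold_locales
  have "A \<in> N" "\<box> \<^bold>\<not> A \<in> N" using N(3) by simp_all
  then show ?thesis using that N(1,2) box_box by blast
qed

lemma J1_refl: "J1 \<subseteq> {B. IL\<^sup>-(\<Sigma>) \<turnstile> B} \<Longrightarrow> A \<rhd> A \<in> M"
proof -
  assume "J1 \<subseteq> {B. IL\<^sup>-(\<Sigma>) \<turnstile> B}"
  then have "IL\<^sup>-(\<Sigma>) \<turnstile> \<box> (A \<^bold>\<rightarrow> A) \<^bold>\<rightarrow> (A \<rhd> A)" by (auto simp: J1_def)
  moreover have "\<box> (A \<^bold>\<rightarrow> A) \<in> M" by (intro theorem_mem Nec taut) (simp add: tautology_def)
  ultimately show ?thesis by (rule theorem_mp)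
qed

lemma J2_trans:
  assumes "J2 \<subseteq> {B. IL\<^sup>-(\<Sigma>) \<turnstile> B}" "A \<rhd> B \<in> M" "B \<rhd> C \<in> M"
  shows "A \<rhd> C \<in> M"
  by (rule theorem_mp[of "(A \<rhd> B) \<^bold>\<and> (B \<rhd> C)"]) (use assms in \<open>auto simp: J2_def\<close>)

lemma J2_plus_trans:
  assumes "J2_plus \<subseteq> {B. IL\<^sup>-(\<Sigma>) \<turnstile> B}" "A \<rhd> (B \<^bold>\<or> C) \<in> M" "B \<rhd> C \<in> M"
  shows "A \<rhd> C \<in> M"
  by (rule theorem_mp[of "(A \<rhd> (B \<^bold>\<or> C)) \<^bold>\<and> (B \<rhd> C)"]) (use assms in \<open>auto simp: J2_plus_def\<close>)

lemma J4_plus_mono: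
  assumes "J4_plus \<subseteq> {B. IL\<^sup>-(\<Sigma>) \<turnstile> B}" "\<box> (A \<^bold>\<rightarrow> B) \<in> M" "C \<rhd> A \<in> M"
  shows "C \<rhd> B \<in> M"
proof -
  have "IL\<^sup>-(\<Sigma>) \<turnstile> \<box> (A \<^bold>\<rightarrow> B) \<^bold>\<rightarrow> ((C \<rhd> A) \<^bold>\<rightarrow> (C \<rhd> B))"
    using assms(1) by (auto simp: J4_plus_def)
  then show ?thesis using theorem_mem assms(2,3) unfolding imp_iff[symmetric] by (meson mp_mem)
qed

lemma J5_mem: "J5 \<subseteq> {B. IL\<^sup>-(\<Sigma>) \<turnstile> B} \<Longrightarrow> \<diamond> A \<rhd> A \<in> M"
  by (auto simp: J5_def intro!: theorem_mem)

lemma box_imp_if_box_neg_and_not: "\<box> \<^bold>\<not> (A \<^bold>\<and> \<^bold>\<not> B) \<in> M \<Longrightarrow> \<box> (A \<^bold>\<rightarrow> B) \<in> M"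
  by (rule box_taut_mono[rotated]) (auto simp: tautology_def)

lemma box_neg_and_not_if_box_imp: "\<box> (A \<^bold>\<rightarrow> B) \<in> M \<Longrightarrow> \<box> \<^bold>\<not> (A \<^bold>\<and> \<^bold>\<not> B) \<in> M"
  by (rule box_taut_mono[rotated]) (auto simp: tautology_def)

end

section \<open>Derivability among the schemata\<close>

lemma provable_if_mem_all_mcs:
  assumes "\<And>M. mcs \<Sigma> M \<Longrightarrow> A \<in> M"
  shows "IL\<^sup>-(\<Sigma>) \<turnstile> A"
proof -
  have "derives \<Sigma> {} A" using Lindenbaum assms by metis
  then show ?thesis by induction (auto intro: MP)
qed

text \<open>\<open>C \<rhd> A\<close> weakens to
  \<open>C \<rhd> ((A \<and> \<not> B) \<or> B)\<close>. The box refutes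
  \<open>A \<and> \<not> B\<close> at all successors, so \<open>J2_plus\<close> can remove this
  disjunct.\<close>

lemma J4_plus_provable_if_J2_plus:
  assumes "J2_plus \<subseteq> {B. IL\<^sup>-(\<Sigma>) \<turnstile> B}"
  shows "J4_plus \<subseteq> {B. IL\<^sup>-(\<Sigma>) \<turnstile> B}"
proof clarify
  fix D assume "D \<in> J4_plus"
  then obtain A B C where D: "D = \<box> (A \<^bold>\<rightarrow> B) \<^bold>\<rightarrow> ((C \<rhd> A) \<^bold>\<rightarrow> (C \<rhd> B))"
    by (auto simp: J4_plus_def)
  show "IL\<^sup>-(\<Sigma>) \<turnstile> D"
  proof (rule provable_if_mem_all_mcs)
    fix M assume "mcs \<Sigma> M"
    then interpret maximal_consistent \<Sigma> M by unfold_locales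
    have "C \<rhd> B \<in> M" if "\<box> (A \<^bold>\<rightarrow> B) \<in> M" "C \<rhd> A \<in> M"
    proof (rule J2_plus_trans[OF assms])
      show "C \<rhd> ((A \<^bold>\<and> \<^bold>\<not> B) \<^bold>\<or> B) \<in> M"
        using that(2) by (rule rhd_mono_right[rotated]) (auto simp: tautology_def)
      show "(A \<^bold>\<and> \<^bold>\<not> B) \<rhd> B \<in> M"
        using that(1) box_neg_and_not_if_box_imp rhd_if_box_neg by blast
    qed
    then show "D \<in> M" by (simp add: D)
  qed
qed

text \<open>\<open>J1\<close> gives \<open>C \<rhd> C\<close>, \<open>J3\<close> joins it with
  \<open>B \<rhd> C\<close>, and \<open>J2\<close> composes the result with the first
  premise.\<close>

lemma J2_plus_provable_if_J1_J2:
  assumes J1: "J1 \<subseteq> {B. IL\<^sup>-(\<Sigma>) \<turnstile> B}" and J2: "J2 \<subseteq> {B. IL\<^sup>-(\<Sigma>) \<turnstile> B}"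
  shows "J2_plus \<subseteq> {B. IL\<^sup>-(\<Sigma>) \<turnstile> B}"
proof clarify
  fix D assume "D \<in> J2_plus"
  then obtain A B C where D: "D = ((A \<rhd> (B \<^bold>\<or> C)) \<^bold>\<and> (B \<rhd> C)) \<^bold>\<rightarrow> (A \<rhd> C)"
    by (auto simp: J2_plus_def)
  show "IL\<^sup>-(\<Sigma>) \<turnstile> D"
  proof (rule provable_if_mem_all_mcs)
    fix M assume "mcs \<Sigma> M"
    then interpret maximal_consistent \<Sigma> M by unfold_locales
    show "D \<in> M"
      unfolding D imp_iff and_iff using J2_trans[OF J2] rhd_or_left J1_refl[OF J1] by blast
  qed
qed

section \<open>The finite canonical model\<close>

primrec subformulas :: "fm \<Rightarrow> fm set" where
  "subformulas (Var n) = {Var n}"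
| "subformulas \<^bold>\<top> = {\<^bold>\<top>}"
| "subformulas \<^bold>\<bottom> = {\<^bold>\<bottom>}"
| "subformulas (\<^bold>\<not> A) = insert (\<^bold>\<not> A) (subformulas A)"
| "subformulas (A \<^bold>\<and> B) = insert (A \<^bold>\<and> B) (subformulas A \<union> subformulas B)"
| "subformulas (A \<^bold>\<or> B) = insert (A \<^bold>\<or> B) (subformulas A \<union> subformulas B)"
| "subformulas (A \<^bold>\<rightarrow> B) = insert (A \<^bold>\<rightarrow> B) (subformulas A \<union> subformulas B)"
| "subformulas (\<box> A) = insert (\<box> A) (subformulas A)"
| "subformulas (A \<rhd> B) = insert (A \<rhd> B) (subformulas A \<union> subformulas B)"

lemma subformulas_refl [simp]: "A \<in> subformulas A"
  by (cases A) auto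

lemma finite_subformulas [simp]: "finite (subformulas A)"
  by (induction A) auto

lemma subformulas_trans: "B \<in> subformulas A \<Longrightarrow> subformulas B \<subseteq> subformulas A"
  by (induction A) auto

text \<open>The diamonds let criticality take account of the instances
  \<open>\<diamond> C \<rhd> C\<close> of \<open>J5\<close>.\<close>

definition with_dia :: "fm set \<Rightarrow> fm set" where
  "with_dia \<Phi> = \<Phi> \<union> Dia ` \<Phi>"

text \<open>Such a formula describes a successor that contains \<open>A\<close> and avoids a given
  list; distinctness leaves finitely many lists.\<close>

definition excluding :: "fm set \<Rightarrow> fm set" where
  "excluding \<Phi> = {A \<^bold>\<and> \<^bold>\<not> Disj Bs | A Bs. A \<in> \<Phi> \<and> distinct Bs \<and> set Bs \<subseteq> with_dia \<Phi>}"

text \<open>The formulas \<open>B \<rhd> C\<close> decide criticality, the boxed negations are the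
  new boxes that Loeb's axiom supplies at successors, and the plain negations keep the set closed
  under removing a box.\<close>

definition adequate :: "fm set \<Rightarrow> fm set" where
  "adequate \<Phi> = with_dia \<Phi> \<union> {B \<rhd> C | B C. B \<in> with_dia \<Phi> \<and> C \<in> \<Phi>}
     \<union> Neg ` (\<Phi> \<union> excluding \<Phi>) \<union> (\<lambda>A. \<box> \<^bold>\<not> A) ` (\<Phi> \<union> excluding \<Phi>)"

lemma finite_adequate:
  assumes "finite \<Phi>" shows "finite (adequate \<Phi>)"
proof -
  have fin: "finite (with_dia \<Phi>)" using assms by (simp add: with_dia_def)
  have "excluding \<Phi> = (\<lambda>(A, Bs). A \<^bold>\<and> \<^bold>\<not> Disj Bs) ` (\<Phi> \<times> {Bs. set Bs \<subseteq> with_dia \<Phi> \<and> distinct Bs})"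
    by (auto simp: excluding_def)
  then have "finite (excluding \<Phi>)" using assms finite_subset_distinct[OF fin] by simp
  moreover have "{B \<rhd> C | B C. B \<in> with_dia \<Phi> \<and> C \<in> \<Phi>} = (\<lambda>(B, C). B \<rhd> C) ` (with_dia \<Phi> \<times> \<Phi>)"
    by auto
  ultimately show ?thesis using assms fin by (simp add: adequate_def)
qed

text \<open>A world \<open>w\<close> stands for the pair of a maximal consistent set, cut down to the finite set
  \<open>adequate \<Phi>\<close>, and a label, the formula to be avoided at the \<open>S\<close>-successors of \<open>w\<close>. The flags
  \<open>inner\<close> and \<open>transitive\<close> impose the frame conditions of \<open>J4_plus\<close> and \<open>J2_plus\<close>. They are independent
  of \<open>\<Sigma>\<close>, as the labelling used for \<open>transitive\<close> is incompatible with the frame condition of \<open>J5\<close>.\<close>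

locale canonical =
  fixes \<Sigma> \<Phi> :: "fm set" and W :: "'w set" and state :: "'w \<Rightarrow> fm set" and label :: "'w \<Rightarrow> fm"
    and inner transitive :: bool
  assumes finite_Phi: "finite \<Phi>"
    and bot_mem: "\<^bold>\<bottom> \<in> \<Phi>"
    and closed: "A \<in> \<Phi> \<Longrightarrow> subformulas A \<subseteq> \<Phi>"
    and finite_W: "finite W"
    and nonempty_W: "W \<noteq> {}"
    and state_mcs: "w \<in> W \<Longrightarrow> \<exists>M. mcs \<Sigma> M \<and> state w = M \<inter> adequate \<Phi>"
    and label_mem: "w \<in> W \<Longrightarrow> label w \<in> \<Phi>"
    and world_exists: "mcs \<Sigma> M \<Longrightarrow> C \<in> \<Phi> \<Longrightarrow> \<exists>w\<in>W. state w = M \<inter> adequate \<Phi> \<and> label w = C"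
    and inner: "inner \<Longrightarrow> J4_plus \<subseteq> {B. IL\<^sup>-(\<Sigma>) \<turnstile> B}"
    and transitive: "transitive \<Longrightarrow> inner \<and> J2_plus \<subseteq> {B. IL\<^sup>-(\<Sigma>) \<turnstile> B}"
begin

section \<open>The canonical frame\<close>

definition R :: "'w rel" where
  "R = {(x, y). x \<in> W \<and> y \<in> W \<and> (\<forall>A. \<box> A \<in> state x \<longrightarrow> A \<in> state y \<and> \<box> A \<in> state y)
         \<and> (\<exists>A. \<box> A \<in> state y \<and> \<box> A \<notin> state x)}"

definition critical :: "'w \<Rightarrow> 'w \<Rightarrow> bool" where
  "critical x y \<longleftrightarrow> (\<forall>B\<in>with_dia \<Phi>. B \<rhd> label y \<in> state x \<longrightarrow> B \<notin> state y)"

text \<open>A \<open>y\<close> that is not critical is related to every world that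
  \<open>inner\<close> allows.\<close>

definition S :: "'w \<Rightarrow> 'w rel" where
  "S x = {(y, z). (x, y) \<in> R \<and> z \<in> W \<and> (inner \<longrightarrow> (x, z) \<in> R)
           \<and> (critical x y \<longrightarrow> label y \<notin> state z \<and> (transitive \<longrightarrow> label z = label y \<and> critical x z))}"

lemma S_iff: "(y, z) \<in> S x \<longleftrightarrow> (x, y) \<in> R \<and> z \<in> W \<and> (inner \<longrightarrow> (x, z) \<in> R)
    \<and> (critical x y \<longrightarrow> label y \<notin> state z \<and> (transitive \<longrightarrow> label z = label y \<and> critical x z))"
  by (simp add: S_def)

lemma mem_with_dia: "A \<in> \<Phi> \<Longrightarrow> A \<in> with_dia \<Phi>" "A \<in> \<Phi> \<Longrightarrow> \<diamond> A \<in> with_dia \<Phi>"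
  by (auto simp: with_dia_def)

lemma mem_adequate:
  "A \<in> \<Phi> \<Longrightarrow> A \<in> adequate \<Phi>"
  "A \<in> with_dia \<Phi> \<Longrightarrow> A \<in> adequate \<Phi>"
  "A \<in> with_dia \<Phi> \<Longrightarrow> B \<in> \<Phi> \<Longrightarrow> A \<rhd> B \<in> adequate \<Phi>"
  "A \<in> \<Phi> \<union> excluding \<Phi> \<Longrightarrow> \<^bold>\<not> A \<in> adequate \<Phi>"
  "A \<in> \<Phi> \<union> excluding \<Phi> \<Longrightarrow> \<box> \<^bold>\<not> A \<in> adequate \<Phi>"
  by (auto simp: adequate_def with_dia_def)

text \<open>Lets the box conditions in \<open>R\<close> pass from maximal consistent sets to their
  finite parts.\<close>

lemma box_mem_adequate: "\<box> A \<in> adequate \<Phi> \<Longrightarrow> A \<in> adequate \<Phi>"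
proof -
  assume "\<box> A \<in> adequate \<Phi>"
  then consider "\<box> A \<in> \<Phi>" | B where "A = \<^bold>\<not> B" "B \<in> \<Phi> \<union> excluding \<Phi>"
    by (auto simp: adequate_def with_dia_def)
  then show ?thesis
  proof cases
    case 1
    then have "A \<in> \<Phi>" using closed[of "\<box> A"] by auto
    then show ?thesis by (rule mem_adequate(1))
  next
    case 2
    then show ?thesis using mem_adequate(4) by blast
  qed
qed

lemma R_if_successor:
  assumes "x \<in> W" "y \<in> W" "state x = M \<inter> adequate \<Phi>" "state y = N \<inter> adequate \<Phi>"
    and "\<And>B. \<box> B \<in> M \<Longrightarrow> B \<in> N \<and> \<box> B \<in> N"
    and "\<box> A \<in> N" "\<box> A \<notin> M" "\<box> A \<in> adequate \<Phi>"
  shows "(x, y) \<in> R"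
  using assms(1,2,5-8) box_mem_adequate unfolding R_def mem_Collect_eq prod.case assms(3,4) by blast

lemma finite_R: "finite R"
  by (rule finite_subset[of _ "W \<times> W"]) (auto simp: R_def finite_W)

lemma R_transitive: "trans R"
  by (rule transI) (auto simp: R_def)

sublocale IL_frame W R S
proof
  \<comment> \<open>The new box demanded in \<open>R\<close> excludes loops; a finite acyclic
    relation is conversely well-founded.\<close>
  have "irrefl R" by (auto simp: irrefl_def R_def)
  then have "acyclic R" by (simp add: R_transitive acyclic_irrefl)
  then show "wf (R\<inverse>)" using finite_R finite_acyclic_wf_converse by blast
qed (auto simp: nonempty_W R_transitive, auto simp: R_def S_def)

text \<open>Loeb's successor construction applied to \<open>A \<and> \<not> Disj Bs\<close>. With
  \<open>Bs\<close> listing every \<open>D\<close> in \<open>with_dia \<Phi>\<close> such that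
  \<open>D \<rhd> C\<close> is in \<open>M\<close>, the world \<open>y\<close> is critical.\<close>

lemma critical_successor:
  assumes x: "x \<in> W" "state x = M \<inter> adequate \<Phi>" and M: "mcs \<Sigma> M"
    and A: "A \<in> \<Phi>" and Bs: "distinct Bs" "set Bs \<subseteq> with_dia \<Phi>" and C: "C \<in> \<Phi>"
    and box: "\<box> (A \<^bold>\<rightarrow> Disj Bs) \<notin> M"
  obtains y where "(x, y) \<in> R" "label y = C" "A \<in> state y" "\<And>B. B \<in> set Bs \<Longrightarrow> B \<notin> state y"
proof -
  interpret maximal_consistent \<Sigma> M using M by unfold_locales
  let ?G = "A \<^bold>\<and> \<^bold>\<not> Disj Bs"
  have G: "\<box> \<^bold>\<not> ?G \<notin> M" using box box_imp_if_box_neg_and_not by blast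
  then obtain N where N: "mcs \<Sigma> N" "?G \<in> N" "\<box> \<^bold>\<not> ?G \<in> N" "\<And>B. \<box> B \<in> M \<Longrightarrow> B \<in> N \<and> \<box> B \<in> N"
    by (rule exists_successor) blast
  interpret N: maximal_consistent \<Sigma> N using N(1) by unfold_locales
  obtain y where y: "y \<in> W" "state y = N \<inter> adequate \<Phi>" "label y = C"
    using world_exists[OF N(1) C] by blast
  have "\<box> \<^bold>\<not> ?G \<in> adequate \<Phi>" using A Bs by (intro mem_adequate) (auto simp: excluding_def)
  then have "(x, y) \<in> R" using R_if_successor[OF x(1) y(1) x(2) y(2)] N G by blast
  moreover have "A \<in> state y" using N(2) A mem_adequate(1) by (simp add: y(2))
  moreover have "B \<notin> state y" if "B \<in> set Bs" for B using N(2) that by (simp add: y(2))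
  ultimately show ?thesis using that y(3) by blast
qed

text \<open>Under \<open>inner\<close>, \<open>J4_plus\<close> shows that
  \<open>\<box> (B \<rightarrow> Disj Bs)\<close> is missing from \<open>M\<close>, so
  \<open>z\<close> can be found above \<open>x\<close>. Otherwise \<open>R1\<close> shows only that
  the implication is unprovable, and \<open>z\<close> may lie anywhere in \<open>W\<close>.\<close>

lemma S_witness:
  assumes x: "x \<in> W" "state x = M \<inter> adequate \<Phi>" and M: "mcs \<Sigma> M"
    and B: "B \<in> \<Phi>" and Bs: "distinct Bs" "set Bs \<subseteq> with_dia \<Phi>" and C: "C \<in> \<Phi>"
    and rhd: "A \<rhd> B \<in> M" "A \<rhd> Disj Bs \<notin> M"
  obtains z where "z \<in> W" "inner \<Longrightarrow> (x, z) \<in> R" "label z = C" "B \<in> state z"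
    "\<And>D. D \<in> set Bs \<Longrightarrow> D \<notin> state z"
proof (cases inner)
  case True
  interpret maximal_consistent \<Sigma> M using M by unfold_locales
  have "\<box> (B \<^bold>\<rightarrow> Disj Bs) \<notin> M" using J4_plus_mono inner True rhd by blast
  then obtain z where "(x, z) \<in> R" "label z = C" "B \<in> state z" "\<And>D. D \<in> set Bs \<Longrightarrow> D \<notin> state z"
    using critical_successor[OF x M B Bs C] by blast
  then show ?thesis using that R_on_W by blast
next
  case False
  interpret maximal_consistent \<Sigma> M using M by unfold_locales
  have "\<not> IL\<^sup>-(\<Sigma>) \<turnstile> B \<^bold>\<rightarrow> Disj Bs" using R1 theorem_mp rhd by blast
  then obtain N where N: "mcs \<Sigma> N" "B \<^bold>\<rightarrow> Disj Bs \<notin> N"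
    using provable_if_mem_all_mcs by blast
  interpret N: maximal_consistent \<Sigma> N using N(1) by unfold_locales
  obtain z where z: "z \<in> W" "state z = N \<inter> adequate \<Phi>" "label z = C"
    using world_exists[OF N(1) C] by blast
  moreover have "B \<in> state z" using N(2) B mem_adequate(1) by (simp add: z(2))
  moreover have "D \<notin> state z" if "D \<in> set Bs" for D using N(2) that by (simp add: z(2))
  ultimately show ?thesis using that False by blast
qed

lemma rhd_iff:
  assumes x: "x \<in> W" and AB: "A \<rhd> B \<in> \<Phi>"
  shows "A \<rhd> B \<in> state x \<longleftrightarrow>
    (\<forall>y. (x, y) \<in> R \<and> A \<in> state y \<longrightarrow> (\<exists>z. (y, z) \<in> S x \<and> B \<in> state z))"
proof -
  have A: "A \<in> \<Phi>" and B: "B \<in> \<Phi>" using closed[OF AB] by auto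
  obtain M where M: "mcs \<Sigma> M" and st: "state x = M \<inter> adequate \<Phi>" using state_mcs x by blast
  interpret maximal_consistent \<Sigma> M using M by unfold_locales
  have finite_with_dia: "finite (with_dia \<Phi>)" using finite_Phi by (simp add: with_dia_def)
  show ?thesis
  proof (intro iffI allI impI)
    fix y assume AB: "A \<rhd> B \<in> state x" and y: "(x, y) \<in> R \<and> A \<in> state y"
    define C where "C = label y"
    have yW: "y \<in> W" and C: "C \<in> \<Phi>" using y R_on_W label_mem C_def by auto
    show "\<exists>z. (y, z) \<in> S x \<and> B \<in> state z"
    proof (cases "critical x y")
      case True
      \<comment> \<open>If \<open>S x\<close> is to be transitive, \<open>z\<close> must itself be
        critical with label \<open>C\<close>, so it must also avoid every \<open>D\<close> with
        \<open>D \<rhd> C\<close> in \<open>M\<close>.\<close>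
      define bad where "bad = (if transitive then {D \<in> with_dia \<Phi>. D \<rhd> C \<in> M} else {})"
      have "finite (insert C bad)" using finite_with_dia by (simp add: bad_def)
      then obtain Bs where Bs: "set Bs = insert C bad" "distinct Bs"
        using finite_distinct_list by blast
      have "A \<rhd> C \<notin> M"
        using True y mem_with_dia(1)[OF A] mem_adequate(3) C by (auto simp: critical_def C_def st)
      have "A \<rhd> Disj Bs \<notin> M"
      proof
        assume *: "A \<rhd> Disj Bs \<in> M"
        have "A \<rhd> C \<in> M"
        proof (cases transitive)
          case True
          \<comment> \<open>\<open>C \<rhd> C\<close> need not belong to \<open>M\<close>, so
            \<open>C\<close> is set apart as the second disjunct for \<open>J2_plus\<close>.\<close>
          let ?Ds = "filter (\<lambda>D. D \<noteq> C) Bs"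
          have "A \<rhd> (Disj ?Ds \<^bold>\<or> C) \<in> M"
            using * by (rule rhd_mono_right[rotated]) (auto simp: tautology_def)
          moreover have "Disj ?Ds \<rhd> C \<in> M"
            using Bs True by (intro Disj_rhd) (auto simp: bad_def)
          ultimately show ?thesis using J2_plus_trans transitive True by blast
        next
          case False
          \<comment> \<open>Here the list contains only \<open>C\<close>.\<close>
          then show ?thesis
            using * Bs by (intro rhd_mono_right[of "Disj Bs" C]) (auto simp: tautology_def bad_def)
        qed
        then show False using \<open>A \<rhd> C \<notin> M\<close> by blast
      qed
      moreover have "set Bs \<subseteq> with_dia \<Phi>" using Bs mem_with_dia(1) C by (auto simp: bad_def)
      ultimately obtain z where z: "z \<in> W" "inner \<Longrightarrow> (x, z) \<in> R" "label z = C" "B \<in> state z"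
        "\<And>D. D \<in> set Bs \<Longrightarrow> D \<notin> state z"
        using S_witness[OF x st M B Bs(2) _ C] AB st by blast
      then have "critical x z" if transitive
        using that Bs by (auto simp: critical_def st bad_def)
      then have "(y, z) \<in> S x" using z y Bs unfolding S_iff C_def by blast
      then show ?thesis using z by blast
    next
      case False
      \<comment> \<open>With nothing to avoid, the empty list is used, and
        \<open>A \<rhd> Disj []\<close> amounts to \<open>\<box> \<not> A\<close>, which the
        successor \<open>y\<close> refutes.\<close>
      have "A \<rhd> Disj [] \<notin> M"
      proof
        assume "A \<rhd> Disj [] \<in> M"
        then have "\<box> \<^bold>\<not> A \<in> state x" using A mem_adequate(5) by (auto simp: st box_neg_iff_rhd_bot)
        then have "\<^bold>\<not> A \<in> state y" using y by (auto simp: R_def)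
        moreover obtain N where "mcs \<Sigma> N" "state y = N \<inter> adequate \<Phi>" using state_mcs yW by blast
        ultimately show False using y by (auto simp: mcs_def)
      qed
      then obtain z where "z \<in> W" "inner \<Longrightarrow> (x, z) \<in> R" "B \<in> state z"
        using S_witness[OF x st M B _ _ C, of "[]" A] AB st by auto
      then show ?thesis using y False unfolding S_iff by blast
    qed
  next
    assume *: "\<forall>y. (x, y) \<in> R \<and> A \<in> state y \<longrightarrow> (\<exists>z. (y, z) \<in> S x \<and> B \<in> state z)"
    show "A \<rhd> B \<in> state x"
    proof (rule ccontr)
      assume "A \<rhd> B \<notin> state x"
      then have AB': "A \<rhd> B \<notin> M" using AB mem_adequate(1) by (auto simp: st)
      \<comment> \<open>Avoiding these formulas makes a successor labelled \<open>B\<close>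
        critical, so that none of its \<open>S x\<close>-successors contains
        \<open>B\<close>.\<close>
      obtain Bs where Bs: "set Bs = {D \<in> with_dia \<Phi>. D \<rhd> B \<in> M}" "distinct Bs"
        using finite_distinct_list[of "{D \<in> with_dia \<Phi>. D \<rhd> B \<in> M}"] finite_with_dia by auto
      have "Disj Bs \<rhd> B \<in> M" using Bs by (intro Disj_rhd) auto
      then have "\<box> (A \<^bold>\<rightarrow> Disj Bs) \<notin> M" using AB' rhd_antimono_box by blast
      then obtain y where y: "(x, y) \<in> R" "label y = B" "A \<in> state y" "\<And>D. D \<in> set Bs \<Longrightarrow> D \<notin> state y"
        using critical_successor[OF x st M A Bs(2) _ B] Bs(1) by blast
      then have "critical x y" using Bs by (auto simp: critical_def st)
      then show False using * y unfolding S_iff by blast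
    qed
  qed
qed

lemma box_iff:
  assumes x: "x \<in> W" and A: "\<box> A \<in> \<Phi>"
  shows "\<box> A \<in> state x \<longleftrightarrow> (\<forall>y. (x, y) \<in> R \<longrightarrow> A \<in> state y)"
proof
  assume *: "\<forall>y. (x, y) \<in> R \<longrightarrow> A \<in> state y"
  obtain M where M: "mcs \<Sigma> M" and st: "state x = M \<inter> adequate \<Phi>" using state_mcs x by blast
  interpret maximal_consistent \<Sigma> M using M by unfold_locales
  show "\<box> A \<in> state x"
  proof (rule ccontr)
    assume "\<box> A \<notin> state x"
    \<comment> \<open>The successor lemma concerns boxed negations, hence the detour through the
      double negation of \<open>A\<close>.\<close>
    then have nA: "\<box> A \<notin> M" using A mem_adequate(1) by (auto simp: st)
    then have "\<box> \<^bold>\<not> \<^bold>\<not> A \<notin> M" using box_taut_mono[of "\<^bold>\<not> \<^bold>\<not> A" A] by (auto simp: tautology_def)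
    then obtain N where N: "mcs \<Sigma> N" "\<^bold>\<not> A \<in> N" "\<box> \<^bold>\<not> \<^bold>\<not> A \<in> N" "\<And>B. \<box> B \<in> M \<Longrightarrow> B \<in> N \<and> \<box> B \<in> N"
      by (rule exists_successor) blast
    interpret N: maximal_consistent \<Sigma> N using N(1) by unfold_locales
    have "\<box> A \<in> N" using N(3) N.box_taut_mono[of "\<^bold>\<not> \<^bold>\<not> A" A] by (auto simp: tautology_def)
    \<comment> \<open>\<open>\<bottom>\<close> serves as a default label.\<close>
    obtain y where y: "y \<in> W" "state y = N \<inter> adequate \<Phi>" using world_exists[OF N(1) bot_mem] by blast
    have "(x, y) \<in> R"
      using R_if_successor[OF x y(1) st y(2) N(4) \<open>\<box> A \<in> N\<close> nA] A mem_adequate(1) by blast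
    then show False using * N(2) y(2) by auto
  qed
qed (simp add: R_def)

section \<open>The truth lemma\<close>

lemma state_boolean:
  assumes "x \<in> W"
  shows "\<^bold>\<bottom> \<notin> state x"
    and "\<^bold>\<top> \<in> \<Phi> \<Longrightarrow> \<^bold>\<top> \<in> state x"
    and "\<^bold>\<not> A \<in> \<Phi> \<Longrightarrow> \<^bold>\<not> A \<in> state x \<longleftrightarrow> A \<notin> state x"
    and "A \<^bold>\<and> B \<in> \<Phi> \<Longrightarrow> A \<^bold>\<and> B \<in> state x \<longleftrightarrow> A \<in> state x \<and> B \<in> state x"
    and "A \<^bold>\<or> B \<in> \<Phi> \<Longrightarrow> A \<^bold>\<or> B \<in> state x \<longleftrightarrow> A \<in> state x \<or> B \<in> state x"
    and "A \<^bold>\<rightarrow> B \<in> \<Phi> \<Longrightarrow> A \<^bold>\<rightarrow> B \<in> state x \<longleftrightarrow> (A \<in> state x \<longrightarrow> B \<in> state x)"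
proof -
  obtain M where M: "mcs \<Sigma> M" and st: "state x = M \<inter> adequate \<Phi>" using state_mcs assms by blast
  interpret maximal_consistent \<Sigma> M using M by unfold_locales
  have mem: "C \<in> adequate \<Phi>" if "D \<in> \<Phi>" "C \<in> subformulas D" for C D
    using that closed mem_adequate(1) by blast
  show "\<^bold>\<bottom> \<notin> state x" by (simp add: st)
  show "\<^bold>\<top> \<in> \<Phi> \<Longrightarrow> \<^bold>\<top> \<in> state x" by (simp add: st mem_adequate(1))
  show "\<^bold>\<not> A \<in> \<Phi> \<Longrightarrow> \<^bold>\<not> A \<in> state x \<longleftrightarrow> A \<notin> state x"
    using mem[of "\<^bold>\<not> A" "\<^bold>\<not> A"] mem[of "\<^bold>\<not> A" A] by (auto simp: st)
  show "A \<^bold>\<and> B \<in> \<Phi> \<Longrightarrow> A \<^bold>\<and> B \<in> state x \<longleftrightarrow> A \<in> state x \<and> B \<in> state x"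
    using mem[of "A \<^bold>\<and> B" "A \<^bold>\<and> B"] mem[of "A \<^bold>\<and> B" A] mem[of "A \<^bold>\<and> B" B] by (auto simp: st)
  show "A \<^bold>\<or> B \<in> \<Phi> \<Longrightarrow> A \<^bold>\<or> B \<in> state x \<longleftrightarrow> A \<in> state x \<or> B \<in> state x"
    using mem[of "A \<^bold>\<or> B" "A \<^bold>\<or> B"] mem[of "A \<^bold>\<or> B" A] mem[of "A \<^bold>\<or> B" B] by (auto simp: st)
  show "A \<^bold>\<rightarrow> B \<in> \<Phi> \<Longrightarrow> A \<^bold>\<rightarrow> B \<in> state x \<longleftrightarrow> (A \<in> state x \<longrightarrow> B \<in> state x)"
    using mem[of "A \<^bold>\<rightarrow> B" "A \<^bold>\<rightarrow> B"] mem[of "A \<^bold>\<rightarrow> B" A] mem[of "A \<^bold>\<rightarrow> B" B] by (auto simp: st)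
qed

definition V :: "'w \<Rightarrow> nat \<Rightarrow> bool" where
  "V x n \<longleftrightarrow> Var n \<in> state x"

lemma truth: "A \<in> \<Phi> \<Longrightarrow> x \<in> W \<Longrightarrow> sat R S V x A \<longleftrightarrow> A \<in> state x"
proof (induction A arbitrary: x)
  case (Box A)
  have "A \<in> \<Phi>" using closed[OF Box.prems(1)] by auto
  then have "(x, y) \<in> R \<Longrightarrow> sat R S V y A \<longleftrightarrow> A \<in> state y" for y
    using Box.IH R_on_W by blast
  then show ?case unfolding box_iff[OF Box.prems(2,1)] sat.simps by blast
next
  case (Rhd A B)
  have "A \<in> \<Phi>" "B \<in> \<Phi>" using closed[OF Rhd.prems(1)] by auto
  then have *: "(x, y) \<in> R \<Longrightarrow> sat R S V y A \<longleftrightarrow> A \<in> state y"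
    "(y, z) \<in> S x \<Longrightarrow> sat R S V z B \<longleftrightarrow> B \<in> state z" for y z
    using Rhd.IH Rhd.prems(2) R_on_W S_on_W by blast+
  show ?case unfolding rhd_iff[OF Rhd.prems(2,1)] sat.simps using * by blast
next
  case (And A B)
  moreover have "A \<in> \<Phi>" "B \<in> \<Phi>" using closed[OF And.prems(1)] by auto
  ultimately show ?case by (simp add: state_boolean(4))
next
  case (Or A B)
  moreover have "A \<in> \<Phi>" "B \<in> \<Phi>" using closed[OF Or.prems(1)] by auto
  ultimately show ?case by (simp add: state_boolean(5))
next
  case (Imp A B)
  moreover have "A \<in> \<Phi>" "B \<in> \<Phi>" using closed[OF Imp.prems(1)] by auto
  ultimately show ?case by (simp add: state_boolean(6))
next
  case (Neg A)
  moreover have "A \<in> \<Phi>" using closed[OF Neg.prems(1)] by auto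
  ultimately show ?case by (simp add: state_boolean(3))
qed (auto simp: V_def state_boolean(1,2))

section \<open>Frame conditions of the canonical frame\<close>

lemma J1_condition:
  assumes "J1 \<subseteq> {B. IL\<^sup>-(\<Sigma>) \<turnstile> B}" "(x, y) \<in> R"
  shows "(y, y) \<in> S x"
proof -
  have x: "x \<in> W" and C: "label y \<in> \<Phi>" and y: "y \<in> W" using assms(2) R_on_W label_mem by auto
  obtain M where M: "mcs \<Sigma> M" and st: "state x = M \<inter> adequate \<Phi>" using state_mcs x by blast
  interpret maximal_consistent \<Sigma> M using M by unfold_locales
  \<comment> \<open>This instance makes a critical \<open>y\<close> avoid its own label; the
    conditions for \<open>transitive\<close> are immediate, as both worlds are
    \<open>y\<close>.\<close>
  have "label y \<rhd> label y \<in> state x"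
    using J1_refl[OF assms(1)] C mem_adequate(3) mem_with_dia(1) by (simp add: st)
  then show ?thesis using assms(2) C mem_with_dia(1) y unfolding S_iff critical_def by blast
qed

text \<open>The flag \<open>transitive\<close> is excluded because \<open>z\<close> may carry a
  label different from that of \<open>y\<close>.\<close>

lemma J5_condition:
  assumes J5: "J5 \<subseteq> {B. IL\<^sup>-(\<Sigma>) \<turnstile> B}" and not_transitive: "\<not> transitive"
    and xy: "(x, y) \<in> R" and yz: "(y, z) \<in> R"
  shows "(y, z) \<in> S x"
proof -
  have W: "x \<in> W" "y \<in> W" "z \<in> W" and C: "label y \<in> \<Phi>" using xy yz R_on_W label_mem by auto
  obtain M where M: "mcs \<Sigma> M" and st: "state x = M \<inter> adequate \<Phi>" using state_mcs W by blast
  obtain N where N: "mcs \<Sigma> N" and st_y: "state y = N \<inter> adequate \<Phi>" using state_mcs W by blast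
  obtain K where K: "mcs \<Sigma> K" and st_z: "state z = K \<inter> adequate \<Phi>" using state_mcs W by blast
  interpret maximal_consistent \<Sigma> M using M by unfold_locales
  interpret N: maximal_consistent \<Sigma> N using N by unfold_locales
  interpret K: maximal_consistent \<Sigma> K using K by unfold_locales
  have "label y \<notin> state z" if crit: "critical x y"
  proof -
    have "\<diamond> label y \<rhd> label y \<in> state x"
      using J5_mem[OF J5] C mem_adequate(3) mem_with_dia(2) by (simp add: st)
    then have "\<diamond> label y \<notin> state y" using crit C mem_with_dia(2) by (auto simp: critical_def)
    then have "\<box> \<^bold>\<not> label y \<in> state y"
      using C mem_adequate(2)[OF mem_with_dia(2)] mem_adequate(5) by (auto simp: st_y)
    then have "\<^bold>\<not> label y \<in> state z" using yz by (auto simp: R_def)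
    then show ?thesis by (auto simp: st_z)
  qed
  then show ?thesis
    unfolding S_iff using xy yz W not_transitive transD[OF R_transitive] by blast
qed

lemma inner_condition: "inner \<Longrightarrow> (y, z) \<in> S x \<Longrightarrow> (x, z) \<in> R"
  unfolding S_iff by blast

text \<open>A critical \<open>y\<close> passes its label and its criticality to each
  \<open>S x\<close>-successor, which therefore imposes the same constraints on the next
  world.\<close>

lemma transitive_condition: "transitive \<Longrightarrow> trans (S x)"
  by (rule transI) (unfold S_iff, metis)

text \<open>The conditions for \<open>J1\<close> and \<open>J5\<close> rest on instances at
  arbitrary labels, hence the inclusions of whole schemata.\<close>

lemma extension_valid:
  assumes "B \<in> \<Sigma>"
    and "B \<in> J1 \<and> J1 \<subseteq> \<Sigma> \<or> B \<in> J5 \<and> J5 \<subseteq> \<Sigma> \<and> \<not> transitive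
      \<or> B \<in> J4_plus \<and> inner \<or> B \<in> J2 \<union> J2_plus \<and> transitive"
  shows "frame_valid W R S B"
proof -
  have \<Sigma>: "\<Sigma> \<subseteq> {B. IL\<^sup>-(\<Sigma>) \<turnstile> B}" by (auto intro: Ax simp: IL_axioms_def)
  consider "B \<in> J1" "J1 \<subseteq> \<Sigma>" | "B \<in> J5" "J5 \<subseteq> \<Sigma>" "\<not> transitive"
    | "B \<in> J4_plus" inner | "B \<in> J2 \<union> J2_plus" transitive
    using assms(2) by blast
  then show ?thesis
  proof cases
    case 1
    then show ?thesis using J1_valid J1_condition \<Sigma> by (metis order_trans)
  next
    case 2
    then show ?thesis using J5_valid J5_condition \<Sigma> by (metis order_trans)
  next
    case 3
    then show ?thesis using J4_plus_valid inner_condition by metis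
  next
    case 4
    then show ?thesis using J2_J2_plus_valid inner_condition transitive_condition transitive by metis
  qed
qed

end

section \<open>Finite countermodels and completeness\<close>

lemma finite_countermodel:
  fixes \<Sigma> :: "fm set" and inner transitive :: bool
  assumes inf: "infinite (UNIV :: 'w set)"
    and unprovable: "\<not> IL\<^sup>-(\<Sigma>) \<turnstile> A"
    and inner: "inner \<Longrightarrow> J4_plus \<subseteq> {B. IL\<^sup>-(\<Sigma>) \<turnstile> B}"
    and transitive: "transitive \<Longrightarrow> inner \<and> J2_plus \<subseteq> {B. IL\<^sup>-(\<Sigma>) \<turnstile> B}"
    and schemata: "\<And>B. B \<in> \<Sigma> \<Longrightarrow> B \<in> J1 \<and> J1 \<subseteq> \<Sigma> \<or> B \<in> J5 \<and> J5 \<subseteq> \<Sigma> \<and> \<not> transitive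
      \<or> B \<in> J4_plus \<and> inner \<or> B \<in> J2 \<union> J2_plus \<and> transitive"
  shows "\<exists>(W :: 'w set) R S. IL_frame W R S \<and> finite W \<and> (\<forall>B\<in>IL_axioms \<Sigma>. frame_valid W R S B)
    \<and> \<not> frame_valid W R S A"
proof -
  define \<Phi> where "\<Phi> = insert \<^bold>\<bottom> (subformulas A)"
  \<comment> \<open>All pairs of a truncated maximal consistent set and a label; being finitely
    many, they embed into the infinite type of worlds, and \<open>g\<close> decodes them.\<close>
  define P where "P = (\<lambda>M. M \<inter> adequate \<Phi>) ` {M. mcs \<Sigma> M} \<times> \<Phi>"
  have fin_\<Phi>: "finite \<Phi>" by (simp add: \<Phi>_def)
  have "P \<subseteq> Pow (adequate \<Phi>) \<times> \<Phi>" by (auto simp: P_def)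
  then have fin_P: "finite P"
    using finite_adequate fin_\<Phi> by (meson finite_Pow_iff finite_SigmaI finite_subset)
  obtain f :: "fm set \<times> fm \<Rightarrow> 'w" where f: "inj_on f P"
    using card_le_inj[OF fin_P] infinite_arbitrarily_large[OF inf] by (metis order_refl)
  define g where "g = inv_into P f"
  obtain M where M: "mcs \<Sigma> M" "A \<notin> M" using unprovable provable_if_mem_all_mcs by blast
  have g: "g (f p) = p" if "p \<in> P" for p using that f by (simp add: g_def)
  interpret canonical \<Sigma> \<Phi> "f ` P" "\<lambda>w. fst (g w)" "\<lambda>w. snd (g w)" inner transitive
  proof
    show "f ` P \<noteq> {}" using M(1) by (auto simp: P_def \<Phi>_def)
    show "\<exists>w\<in>f ` P. fst (g w) = N \<inter> adequate \<Phi> \<and> snd (g w) = C" if "mcs \<Sigma> N" "C \<in> \<Phi>" for N C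
      using that by (intro bexI[of _ "f (N \<inter> adequate \<Phi>, C)"]) (auto simp: g P_def)
    show "subformulas B \<subseteq> \<Phi>" if "B \<in> \<Phi>" for B
      using that subformulas_trans by (auto simp: \<Phi>_def)
  qed (use g fin_\<Phi> fin_P inner transitive in \<open>auto simp: P_def \<Phi>_def\<close>)
  obtain w where "w \<in> f ` P" "fst (g w) = M \<inter> adequate \<Phi>"
    using world_exists[OF M(1) bot_mem] by blast
  then have "\<not> frame_valid (f ` P) R S A"
    using truth[of A w] M(2) by (auto simp: \<Phi>_def frame_valid_def)
  moreover have "frame_valid (f ` P) R S B" if "B \<in> IL_axioms \<Sigma>" for B
    using that IL_axioms_valid extension_valid schemata by blast
  ultimately show ?thesis using IL_frame_axioms finite_W by blast
qed

text \<open>Soundness covers all frames, hence the finite ones; the finite countermodel gives both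
  converses by contraposition.\<close>

theorem theorem5p1:
  fixes \<Sigma> :: "fm set" and A :: fm
  assumes inf: "infinite (UNIV :: 'w set)"
    and L: "\<Sigma> \<in> {{}, J4_plus, J1, J5, J2_plus, J1 \<union> J4_plus, J4_plus \<union> J5,
                 J1 \<union> J5, J1 \<union> J2, J1 \<union> J4_plus \<union> J5}"
  shows "((IL\<^sup>-(\<Sigma>) \<turnstile> A) \<longleftrightarrow>
            (\<forall>(W :: 'w set) R S. IL_frame W R S \<and> (\<forall>B\<in>IL_axioms \<Sigma>. frame_valid W R S B)
               \<longrightarrow> frame_valid W R S A)) \<and>
         ((IL\<^sup>-(\<Sigma>) \<turnstile> A) \<longleftrightarrow>
            (\<forall>(W :: 'w set) R S. IL_frame W R S \<and> finite W \<and> (\<forall>B\<in>IL_axioms \<Sigma>. frame_valid W R S B)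
               \<longrightarrow> frame_valid W R S A))"
proof -
  \<comment> \<open>\<open>J1 \<union> J2\<close> is included because it derives
    \<open>J2_plus\<close>.\<close>
  define transitive where "transitive \<longleftrightarrow> \<Sigma> = J2_plus \<or> \<Sigma> = J1 \<union> J2"
  define inner where "inner \<longleftrightarrow> J4_plus \<subseteq> \<Sigma> \<or> transitive"
  have \<Sigma>: "\<Sigma> \<subseteq> {B. IL\<^sup>-(\<Sigma>) \<turnstile> B}" by (auto intro: Ax simp: IL_axioms_def)
  have J2: "J2_plus \<subseteq> {B. IL\<^sup>-(\<Sigma>) \<turnstile> B}" if transitive
    using that \<Sigma> J2_plus_provable_if_J1_J2[of \<Sigma>] by (auto simp: transitive_def)
  then have J4: "J4_plus \<subseteq> {B. IL\<^sup>-(\<Sigma>) \<turnstile> B}" if inner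
    using that \<Sigma> J4_plus_provable_if_J2_plus unfolding inner_def by blast
  \<comment> \<open>This formula has \<open>\<rhd>\<close> as main operator, whereas all instances
    of \<open>J1\<close>, \<open>J2\<close> and \<open>J2_plus\<close> are implications.\<close>
  have "\<diamond> \<^bold>\<bottom> \<rhd> \<^bold>\<bottom> \<in> J5" "\<diamond> \<^bold>\<bottom> \<rhd> \<^bold>\<bottom> \<notin> J2_plus \<union> J1 \<union> J2"
    by (auto simp: J5_def J2_plus_def J1_def J2_def)
  then have J5: "\<not> transitive" if "J5 \<subseteq> \<Sigma>"
    using that unfolding transitive_def by blast
  have schemata: "B \<in> J1 \<and> J1 \<subseteq> \<Sigma> \<or> B \<in> J5 \<and> J5 \<subseteq> \<Sigma> \<and> \<not> transitive
      \<or> B \<in> J4_plus \<and> inner \<or> B \<in> J2 \<union> J2_plus \<and> transitive" if "B \<in> \<Sigma>" for B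
  proof -
    have "B \<in> J1 \<and> J1 \<subseteq> \<Sigma> \<or> B \<in> J5 \<and> J5 \<subseteq> \<Sigma> \<or> B \<in> J4_plus \<and> J4_plus \<subseteq> \<Sigma>
        \<or> B \<in> J2 \<union> J2_plus \<and> transitive"
      using L that unfolding transitive_def by (elim insertE emptyE) (simp_all, blast+)
    then show ?thesis using J5 inner_def by blast
  qed
  have "\<exists>(W :: 'w set) R S. IL_frame W R S \<and> finite W \<and> (\<forall>B\<in>IL_axioms \<Sigma>. frame_valid W R S B)
      \<and> \<not> frame_valid W R S A" if "\<not> IL\<^sup>-(\<Sigma>) \<turnstile> A"
  proof (rule finite_countermodel[OF inf that J4 _ schemata])
    show "inner \<and> J2_plus \<subseteq> {B. IL\<^sup>-(\<Sigma>) \<turnstile> B}" if transitive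
      using that J2 by (simp add: inner_def)
  qed
  moreover have "frame_valid W R S A"
    if "IL\<^sup>-(\<Sigma>) \<turnstile> A" "IL_frame W R S" "\<forall>B\<in>IL_axioms \<Sigma>. frame_valid W R S B" for W :: "'w set" and R S
    using IL_frame.soundness[OF that(2,1)] that(3) by blast
  ultimately show ?thesis by meson
qed

end
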